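(* Let $X$ be a first countable, Hausdorff topological vector space over $\mathbb{K}$ ($=\mathbb{R}$ or $\mathbb{C}$), let $\mu$ be a non-zero measure on the Borel $\sigma$-algebra of $X$ that is finite on bounded sets, and let $K\subset X$ be a bounded, open neighbourhood of the origin. If $E\subset X$ is topologically dense in $X$, and if $(u,E)$, with $u\in X$, satisfies the uniformity condition: there exists $(v^{\ast},r^{\ast})\in E\times(0,1)$ such that, for all $r\in(0,r^{\ast})$, $$f(u-v^{\ast},r)=\sup_{z\in u-E} f(z,r),$$ then $u$ is an $E$-weak mode of $\mu$ if and only if $u$ is a strong mode of $\mu$.
   Context: For $x\in X$ and real $r>0$, put $K(x,r)=x+rK$ and $f(x,r)=\mu(K(x,r))$, which is finite and nonnegative. For $E\subset X$, $u-E=\{u-v : v\in E\}$. $\operatorname{supp}(\mu)$ is the topological support of $\mu$, i.e. the set of points all of whose open neighbourhoods have positive $\mu$-measure. A strong mode of $\mu$ is any $u\in X$ satisfying $\lim_{r\downarrow 0}\frac{\sup_{z\in X} f(z,r)}{f(u,r)}=1$. An $E$-weak mode of $\mu$ is any $u\in\operatorname{supp}(\mu)$ such that $\lim_{r\downarrow 0}\frac{f(u-v,r)}{f(u,r)}\le 1$ for every $v\in E$.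
   Formalization: In the definition of E-weak mode, "lim ≤ 1" is replaced by "lim sup ≤ 1"; the two agree when the limits exist, and if existence of the limits were required, a strong mode need not be an E-weak mode (f(u-v,r)/f(u,r) may oscillate). *)

theory Defs
  imports "HOL-Analysis.Analysis"
begin

text \<open>
  The scalar field is a type of class \<^class>\<open>real_normed_field\<close>. By the Gelfand--Mazur theorem for
  real normed division algebras, the instances of this class are, up to isometric isomorphism,
  exactly the real and the complex numbers.
\<close>

locale topological_vector_space = vector_space smul
  for smul :: "'k::real_normed_field \<Rightarrow> 'a::topological_ab_group_add \<Rightarrow> 'a" +
  assumes continuous_scale: "continuous_on UNIV (\<lambda>(c, x). smul c x)"

text \<open>Boundedness is meant in the sense of von Neumann: every neighbourhood of the origin absorbs
  the set.\<close>

definition tvs_bounded ::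
  "('k::real_normed_field \<Rightarrow> 'a::{topological_space, zero} \<Rightarrow> 'a) \<Rightarrow> 'a set \<Rightarrow> bool" where
  "tvs_bounded smul B \<longleftrightarrow>
     (\<forall>U. open U \<and> 0 \<in> U \<longrightarrow> (\<exists>s>0. \<forall>t. s \<le> norm t \<longrightarrow> B \<subseteq> smul t ` U))"

definition topological_support :: "'a::topological_space measure \<Rightarrow> 'a set" where
  "topological_support \<mu> = {x. \<forall>U. open U \<and> x \<in> U \<longrightarrow> emeasure \<mu> U > 0}"

definition translate_dilate ::
  "('k::real_normed_field \<Rightarrow> 'a::plus \<Rightarrow> 'a) \<Rightarrow> 'a set \<Rightarrow> 'a \<Rightarrow> real \<Rightarrow> 'a set" where
  "translate_dilate smul K x r = (\<lambda>k. x + smul (of_real r) k) ` K"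

text \<open>The function $f$ takes extended values because, although $f(z,r)$ is finite, its supremum
  over $z$ need not be.\<close>

definition small_ball_measure ::
  "('k::real_normed_field \<Rightarrow> 'a::plus \<Rightarrow> 'a) \<Rightarrow> 'a measure \<Rightarrow> 'a set \<Rightarrow> 'a \<Rightarrow> real \<Rightarrow> ennreal" where
  "small_ball_measure smul \<mu> K x r = emeasure \<mu> (translate_dilate smul K x r)"

text \<open>In \<^typ>\<open>ennreal\<close> a quotient with denominator 0 is 0 or infinite, so the limit being 1 forces
  $f(u,r) > 0$ for all sufficiently small $r$.\<close>

definition strong_mode ::
  "('k::real_normed_field \<Rightarrow> 'a::plus \<Rightarrow> 'a) \<Rightarrow> 'a measure \<Rightarrow> 'a set \<Rightarrow> 'a \<Rightarrow> bool" where
  "strong_mode smul \<mu> K u \<longleftrightarrow>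
     ((\<lambda>r. (SUP z. small_ball_measure smul \<mu> K z r) / small_ball_measure smul \<mu> K u r)
        \<longlongrightarrow> 1) (at_right 0)"

text \<open>
  The ratios $f(u-v,r)/f(u,r)$ need not converge as $r$ decreases to 0, and the condition
  ``$\lim \le 1$'' is read as ``$\limsup \le 1$''; the two agree whenever the limit exists.
  If convergence were part of the definition, strong modes would not be weak modes: on the reals
  with $K = (-1,1)$, take the Lebesgue density that is 1 on $[-1,1]$, alternates between 1/4 and 1/2
  on the dyadic annuli in $[4,6]$ around 5, and vanishes elsewhere. Then 0 is a strong mode, but
  $f(5,r)/f(0,r)$ oscillates.
\<close>

definition weak_mode ::
  "('k::real_normed_field \<Rightarrow> 'a::{topological_space, plus, minus} \<Rightarrow> 'a) \<Rightarrow> 'a measure \<Rightarrow> 'a set \<Rightarrow>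
     'a set \<Rightarrow> 'a \<Rightarrow> bool" where
  "weak_mode smul \<mu> K E u \<longleftrightarrow>
     u \<in> topological_support \<mu> \<and>
     (\<forall>v\<in>E. Limsup (at_right 0)
        (\<lambda>r. small_ball_measure smul \<mu> K (u - v) r / small_ball_measure smul \<mu> K u r) \<le> 1)"

definition uniformity_condition ::
  "('k::real_normed_field \<Rightarrow> 'a::{plus, minus} \<Rightarrow> 'a) \<Rightarrow> 'a measure \<Rightarrow> 'a set \<Rightarrow> 'a set \<Rightarrow> 'a \<Rightarrow> bool" where
  "uniformity_condition smul \<mu> K E u \<longleftrightarrow>
     (\<exists>v\<in>E. \<exists>r\<^sub>0\<in>{0<..<1}. \<forall>r\<in>{0<..<r\<^sub>0}.
        small_ball_measure smul \<mu> K (u - v) r =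
        (SUP z\<in>(\<lambda>v. u - v) ` E. small_ball_measure smul \<mu> K z r))"

end

theory Submission
  imports Defs
begin

text \<open>
  Write $f(x,r)$ for the measure of $x + rK$ and $M(r)$ for its supremum over all $x$. A weak mode
  compares $f(u,r)$ with the values $f(z,r)$ one point $z$ at a time, a strong mode with $M(r)$
  itself. What connects them is that $x \<mapsto> f(x,r)$ is lower semicontinuous: $K$ is open, so a
  point of $x + rK$ lies in $x_n + rK$ for all large $n$ whenever $x_n \<longrightarrow> x$
  (\<open>small_ball_measure_le_of_tendsto\<close>). A lower semicontinuous function has the same supremum
  on a dense set as on the whole space (\<open>SUP_small_ball_measure_dense\<close>), and $u - E$ is dense
  along with $E$. The uniformity condition therefore says that one fixed competitor $u - v$, with
  $v \<in> E$, attains $M(r)$ for all small $r$.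

  If $u$ is a weak mode, then $M(r)/f(u,r) = f(u-v,r)/f(u,r)$ has upper limit at most 1. It is also
  at least 1, because $f(u,r)$ is positive ($u$ lies in the support and $u + rK$ is open) and finite
  ($u + rK$ is bounded, \<open>tvs_bounded_translate_dilate\<close>). Hence the ratio tends to 1.

  Conversely, $f(u-w,r)/f(u,r) \<le> M(r)/f(u,r)$ for every $w$, so a strong mode satisfies the ratio
  condition. It lies in the support because the sets $u + rK$ shrink into any neighbourhood of $u$
  as $r$ decreases to 0 (\<open>eventually_translate_dilate_subset\<close>), and $f(u,r)$ must be positive for
  small $r$.
\<close>

section \<open>Translated dilates of a bounded open set\<close>

context topological_vector_space
begin

lemma continuous_on_scale [continuous_intros]:
  assumes "continuous_on S c" and "continuous_on S g"
  shows "continuous_on S (\<lambda>x. smul (c x) (g x))"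
  using continuous_on_compose2[OF continuous_scale, of S "\<lambda>x. (c x, g x)"] assms
  by (simp add: continuous_on_Pair)

text \<open>Describing $x + rK$ as a preimage rather than an image lets continuity in the point and in
  the centre be used symmetrically: the first gives openness, the second semicontinuity.\<close>

lemma mem_translate_dilate_iff:
  assumes "r \<noteq> 0"
  shows "y \<in> translate_dilate smul K x r \<longleftrightarrow> smul (inverse (of_real r)) (y - x) \<in> K"
proof
  assume "smul (inverse (of_real r)) (y - x) \<in> K"
  moreover have "y = x + smul (of_real r) (smul (inverse (of_real r)) (y - x))"
    using assms by simp
  ultimately show "y \<in> translate_dilate smul K x r"
    unfolding translate_dilate_def by blast
next
  assume "y \<in> translate_dilate smul K x r"
  then show "smul (inverse (of_real r)) (y - x) \<in> K"
    using assms unfolding translate_dilate_def by auto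
qed

lemma open_translate_dilate:
  assumes "open K" and "r \<noteq> 0"
  shows "open (translate_dilate smul K x r)"
proof -
  have "translate_dilate smul K x r = (\<lambda>y. smul (inverse (of_real r)) (y - x)) -` K"
    using assms(2) by (auto simp: mem_translate_dilate_iff)
  moreover have "continuous_on UNIV (\<lambda>y. smul (inverse (of_real r)) (y - x))"
    by (intro continuous_intros)
  ultimately show ?thesis
    using assms(1) by (simp add: open_vimage)
qed

lemma center_in_translate_dilate: "0 \<in> K \<Longrightarrow> x \<in> translate_dilate smul K x r"
  unfolding translate_dilate_def by (auto intro!: image_eqI[where x = 0])

text \<open>As $|t|$ grows, $t^{-1}x$ tends to $0 \<cdot> x = 0$ and so enters any neighbourhood of the
  origin.\<close>

lemma tvs_bounded_singleton: "tvs_bounded smul {x}"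
  unfolding tvs_bounded_def
proof (intro allI impI)
  fix U :: "'a set"
  assume U: "open U \<and> 0 \<in> U"
  have "continuous_on UNIV (\<lambda>c. smul c x)"
    by (intro continuous_intros)
  then have "open ((\<lambda>c. smul c x) -` U)"
    using U by (simp add: open_vimage)
  moreover have "0 \<in> (\<lambda>c. smul c x) -` U"
    using U by simp
  ultimately obtain d where d: "d > 0" "ball 0 d \<subseteq> (\<lambda>c. smul c x) -` U"
    by (rule openE)
  show "\<exists>s>0. \<forall>t. s \<le> norm t \<longrightarrow> {x} \<subseteq> smul t ` U"
  proof (intro exI conjI allI impI)
    show "0 < 2 / d" using d(1) by simp
    fix t :: 'k
    assume t: "2 / d \<le> norm t"
    have "0 < 2 / d" using d(1) by simp
    also note t
    finally have "t \<noteq> 0" by simp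
    have "inverse (norm t) \<le> inverse (2 / d)"
      using t \<open>0 < 2 / d\<close> by (rule le_imp_inverse_le)
    also have "\<dots> < d" using d(1) by simp
    finally have "inverse t \<in> ball 0 d"
      using \<open>t \<noteq> 0\<close> by (simp add: nonzero_norm_inverse)
    with d(2) have "smul (inverse t) x \<in> U" by blast
    then have "smul t (smul (inverse t) x) \<in> smul t ` U"
      by (rule imageI)
    then show "{x} \<subseteq> smul t ` U"
      using \<open>t \<noteq> 0\<close> by simp
  qed
qed

lemma tvs_bounded_dilate:
  assumes "tvs_bounded smul B" and "r > 0"
  shows "tvs_bounded smul (smul (of_real r) ` B)"
  unfolding tvs_bounded_def
proof (intro allI impI)
  fix U :: "'a set"
  assume "open U \<and> 0 \<in> U"
  then obtain s where s: "s > 0" "\<And>t. s \<le> norm t \<Longrightarrow> B \<subseteq> smul t ` U"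
    using assms(1) unfolding tvs_bounded_def by blast
  show "\<exists>s>0. \<forall>t. s \<le> norm t \<longrightarrow> smul (of_real r) ` B \<subseteq> smul t ` U"
  proof (intro exI conjI allI impI)
    show "0 < r * s" using s(1) assms(2) by simp
    fix t :: 'k
    assume t: "r * s \<le> norm t"
    have "s \<le> norm (t / of_real r)"
      using t \<open>r > 0\<close> by (simp add: norm_divide field_simps)
    from s(2)[OF this] have "smul (of_real r) ` B \<subseteq> smul (of_real r) ` smul (t / of_real r) ` U"
      by (rule image_mono)
    also have "\<dots> = smul t ` U"
      using \<open>r > 0\<close> by (simp add: image_image)
    finally show "smul (of_real r) ` B \<subseteq> smul t ` U" .
  qed
qed

text \<open>Continuity of addition at the origin provides $V$ and $W$ with $V + W \<subseteq> U$; a scalar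
  for which $V$ absorbs $A$ and $W$ absorbs $B$ makes $U$ absorb $A + B$.\<close>

lemma tvs_bounded_plus:
  assumes "tvs_bounded smul A" and "tvs_bounded smul B"
  shows "tvs_bounded smul {a + b | a b. a \<in> A \<and> b \<in> B}"
  unfolding tvs_bounded_def
proof (intro allI impI)
  fix U :: "'a set"
  assume U: "open U \<and> 0 \<in> U"
  have "open ((\<lambda>p. fst p + snd p) -` U)"
    using U by (intro open_vimage continuous_intros) auto
  moreover have "(0, 0) \<in> (\<lambda>p. fst p + snd p) -` U"
    using U by simp
  ultimately obtain V W where VW: "open V" "open W" "0 \<in> V" "0 \<in> W"
    "V \<times> W \<subseteq> (\<lambda>p. fst p + snd p) -` U"
    by (rule open_prod_elim) auto
  obtain s where s: "s > 0" "\<And>t. s \<le> norm t \<Longrightarrow> A \<subseteq> smul t ` V"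
    using assms(1) VW unfolding tvs_bounded_def by blast
  obtain s' where s': "s' > 0" "\<And>t. s' \<le> norm t \<Longrightarrow> B \<subseteq> smul t ` W"
    using assms(2) VW unfolding tvs_bounded_def by blast
  show "\<exists>s>0. \<forall>t. s \<le> norm t \<longrightarrow> {a + b | a b. a \<in> A \<and> b \<in> B} \<subseteq> smul t ` U"
  proof (intro exI conjI allI impI subsetI)
    show "0 < max s s'" using s(1) by simp
    fix t :: 'k and x
    assume t: "max s s' \<le> norm t" and "x \<in> {a + b | a b. a \<in> A \<and> b \<in> B}"
    then obtain a b where ab: "x = a + b" "a \<in> A" "b \<in> B" by blast
    obtain v where v: "v \<in> V" "a = smul t v"
      using s(2)[of t] t ab by auto
    obtain w where w: "w \<in> W" "b = smul t w"
      using s'(2)[of t] t ab by auto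
    have "v + w \<in> U" using VW(5) v w by auto
    moreover have "x = smul t (v + w)"
      using ab v w by (simp add: scale_right_distrib)
    ultimately show "x \<in> smul t ` U" by blast
  qed
qed

lemma tvs_bounded_translate_dilate:
  assumes "tvs_bounded smul K" and "r > 0"
  shows "tvs_bounded smul (translate_dilate smul K x r)"
proof -
  have "translate_dilate smul K x r = {a + b | a b. a \<in> {x} \<and> b \<in> smul (of_real r) ` K}"
    unfolding translate_dilate_def by auto
  then show ?thesis
    using tvs_bounded_plus[OF tvs_bounded_singleton tvs_bounded_dilate[OF assms]] by simp
qed

text \<open>Boundedness read backwards: if $K \<subseteq> tV$ for all large $|t|$, then $rK \<subseteq> V$ with
  $r = t^{-1}$ small.\<close>

lemma eventually_translate_dilate_subset:
  assumes "tvs_bounded smul K" and "open U" and "x \<in> U"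
  shows "\<forall>\<^sub>F r in at_right 0. translate_dilate smul K x r \<subseteq> U"
proof -
  have "open ((\<lambda>y. x + y) -` U)"
    using assms(2) by (intro open_vimage continuous_intros)
  moreover have "0 \<in> (\<lambda>y. x + y) -` U"
    using assms(3) by simp
  ultimately obtain s where s: "s > 0"
    "\<And>t. s \<le> norm t \<Longrightarrow> K \<subseteq> smul t ` ((\<lambda>y. x + y) -` U)"
    using assms(1) unfolding tvs_bounded_def by blast
  have "translate_dilate smul K x r \<subseteq> U" if r: "0 < r" "r < 1 / s" for r
  proof
    fix y assume "y \<in> translate_dilate smul K x r"
    then obtain k where k: "k \<in> K" "y = x + smul (of_real r) k"
      unfolding translate_dilate_def by blast
    have "s \<le> inverse r"
      using r s(1) by (simp add: field_simps)
    also have "inverse r = norm (inverse (of_real r) :: 'k)"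
      unfolding norm_inverse norm_of_real using r(1) by simp
    finally have "k \<in> smul (inverse (of_real r)) ` ((\<lambda>y. x + y) -` U)"
      using s(2) k(1) by blast
    then obtain v where v: "x + v \<in> U" "k = smul (inverse (of_real r)) v"
      by blast
    then show "y \<in> U"
      unfolding k(2) v(2) using r(1) by simp
  qed
  then have subset: "\<And>r. 0 < r \<and> r < 1 / s \<Longrightarrow> translate_dilate smul K x r \<subseteq> U"
    by simp
  have "\<forall>\<^sub>F r in at_right 0. 0 < r \<and> r < 1 / s"
    unfolding eventually_at_right_field using s(1) by (intro exI[of _ "1 / s"]) auto
  then show ?thesis
    by (rule eventually_mono) (rule subset)
qed

section \<open>Lower semicontinuity of the small ball measure\<close>

text \<open>This is Fatou's lemma for the indicators of the sets $x_n + rK$. For sets it reduces to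
  continuity from below along the increasing tail intersections, each of which lies in one of the
  sets $x_n + rK$.\<close>

lemma small_ball_measure_le_of_tendsto:
  assumes "sets \<mu> = sets borel" and "open K" and "r \<noteq> 0" and X: "X \<longlonglongrightarrow> x"
    and le: "\<And>n. small_ball_measure smul \<mu> K (X n) r \<le> C"
  shows "small_ball_measure smul \<mu> K x r \<le> C"
proof -
  let ?B = "\<lambda>z. translate_dilate smul K z r"
  have meas: "?B z \<in> sets \<mu>" for z
    using open_translate_dilate assms by simp
  let ?A = "\<lambda>n. \<Inter>m\<in>{n..}. ?B (X m)"
  have A: "?A n \<in> sets \<mu>" for n
    using meas by (intro sets.countable_INT') auto
  have "?B x \<subseteq> (\<Union>n. ?A n)"
  proof
    fix y assume y: "y \<in> ?B x"
    let ?h = "\<lambda>z. smul (inverse (of_real r)) (y - z)"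
    have "continuous_on UNIV ?h"
      by (intro continuous_intros)
    then have "(\<lambda>n. ?h (X n)) \<longlonglongrightarrow> ?h x"
      by (rule continuous_on_tendsto_compose) (use X in auto)
    moreover have "?h x \<in> K"
      using y \<open>r \<noteq> 0\<close> by (simp add: mem_translate_dilate_iff)
    ultimately have "\<forall>\<^sub>F n in sequentially. ?h (X n) \<in> K"
      using \<open>open K\<close> by (auto dest: topological_tendstoD)
    then show "y \<in> (\<Union>n. ?A n)"
      using \<open>r \<noteq> 0\<close> by (auto simp: mem_translate_dilate_iff eventually_sequentially)
  qed
  then have "emeasure \<mu> (?B x) \<le> emeasure \<mu> (\<Union>n. ?A n)"
    using A by (intro emeasure_mono) auto
  also have "\<dots> = (SUP n. emeasure \<mu> (?A n))"
    using A by (intro SUP_emeasure_incseq[symmetric]) (auto simp: incseq_def)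
  also have "\<dots> \<le> C"
  proof (rule SUP_least)
    fix n
    have "emeasure \<mu> (?A n) \<le> emeasure \<mu> (?B (X n))"
      using meas by (intro emeasure_mono) auto
    also have "\<dots> \<le> C" using le by (simp add: small_ball_measure_def)
    finally show "emeasure \<mu> (?A n) \<le> C" .
  qed
  finally show ?thesis by (simp add: small_ball_measure_def)
qed

end

text \<open>First countability enters here, to reach every point by a sequence from the dense set.\<close>

lemma SUP_small_ball_measure_dense:
  fixes smul :: "'k::real_normed_field \<Rightarrow>
      'a::{first_countable_topology, topological_ab_group_add} \<Rightarrow> 'a"
  assumes "topological_vector_space smul" and "sets \<mu> = sets borel"
    and "open K" and "r \<noteq> 0" and "closure D = UNIV"
  shows "(SUP z\<in>D. small_ball_measure smul \<mu> K z r) = (SUP z. small_ball_measure smul \<mu> K z r)"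
proof (rule antisym)
  show "(SUP z. small_ball_measure smul \<mu> K z r) \<le> (SUP z\<in>D. small_ball_measure smul \<mu> K z r)"
  proof (rule SUP_least)
    fix x :: 'a
    have "x \<in> closure D" using assms(5) by simp
    then obtain X where X: "\<And>n. X n \<in> D" "X \<longlonglongrightarrow> x"
      unfolding closure_sequential by blast
    show "small_ball_measure smul \<mu> K x r \<le> (SUP z\<in>D. small_ball_measure smul \<mu> K z r)"
      using assms(1-4) X(2)
      by (rule topological_vector_space.small_ball_measure_le_of_tendsto) (rule SUP_upper, rule X(1))
  qed
next
  show "(SUP z\<in>D. small_ball_measure smul \<mu> K z r) \<le> (SUP z. small_ball_measure smul \<mu> K z r)"
    by (rule SUP_subset_mono) simp_all
qed

lemma closure_reflect_UNIV:
  fixes u :: "'a::topological_ab_group_add"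
  assumes "closure E = UNIV"
  shows "closure ((\<lambda>v. u - v) ` E) = UNIV"
proof -
  have "UNIV = (\<lambda>v. u - v) ` closure E"
    unfolding assms by (rule surjI[symmetric, of _ "\<lambda>x. u - x"]) simp
  also have "\<dots> \<subseteq> closure ((\<lambda>v. u - v) ` E)"
    by (rule continuous_image_closure_subset[where A = UNIV]) (auto intro!: continuous_intros)
  finally show ?thesis by blast
qed

section \<open>Weak and strong modes\<close>

theorem corollary2p7:
  fixes smul :: "'k::real_normed_field \<Rightarrow>
      'a::{first_countable_topology, t2_space, topological_ab_group_add} \<Rightarrow> 'a"
    and \<mu> :: "'a measure"
    and K E :: "'a set"
    and u :: 'a
  assumes "topological_vector_space smul"
    and "sets \<mu> = sets borel"
    and "emeasure \<mu> (space \<mu>) \<noteq> 0"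
    and "\<And>B. B \<in> sets borel \<Longrightarrow> tvs_bounded smul B \<Longrightarrow> emeasure \<mu> B < \<infinity>"
    and "open K" and "0 \<in> K" and "tvs_bounded smul K"
    and "closure E = UNIV"
    and "uniformity_condition smul \<mu> K E u"
  shows "weak_mode smul \<mu> K E u \<longleftrightarrow> strong_mode smul \<mu> K u"
proof -
  interpret topological_vector_space smul by fact
  let ?f = "small_ball_measure smul \<mu> K"
  let ?M = "\<lambda>r. SUP z. ?f z r"
  obtain v r\<^sub>0 where v: "v \<in> E" and r0: "0 < r\<^sub>0"
    and attained: "\<And>r. 0 < r \<Longrightarrow> r < r\<^sub>0 \<Longrightarrow> ?f (u - v) r = (SUP z\<in>(\<lambda>v. u - v) ` E. ?f z r)"
    using assms(9) unfolding uniformity_condition_def by auto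
  have attains_sup: "\<forall>\<^sub>F r in at_right 0. ?f (u - v) r = ?M r"
    unfolding eventually_at_right_field
    using r0 attained
      SUP_small_ball_measure_dense[OF assms(1,2,5) _ closure_reflect_UNIV[OF assms(8)], of _ u]
    by (intro exI[of _ r\<^sub>0]) auto
  have pos: "\<forall>\<^sub>F r in at_right (0::real). 0 < r"
    by (rule eventually_at_right_less)
  show ?thesis
  proof
    assume weak: "weak_mode smul \<mu> K E u"
    \<comment> \<open>Cancelling $f(u,r)$ is legitimate in the extended nonnegative reals only once it is known
      to be neither 0 nor infinite.\<close>
    have "\<forall>\<^sub>F r in at_right 0. 1 \<le> ?f (u - v) r / ?f u r"
      using attains_sup pos
    proof eventually_elim
      case (elim r)
      have K: "open (translate_dilate smul K u r)"
        using open_translate_dilate assms(5) elim by simp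
      then have "0 < ?f u r"
        using weak center_in_translate_dilate[OF assms(6)]
        unfolding weak_mode_def topological_support_def small_ball_measure_def by blast
      moreover have "?f u r < \<infinity>"
        unfolding small_ball_measure_def
        using elim K by (intro assms(4) tvs_bounded_translate_dilate assms(7)) auto
      ultimately have "?f u r / ?f u r = 1"
        by (simp add: ennreal_divide_self)
      moreover have "?f u r / ?f u r \<le> ?M r / ?f u r"
        by (intro divide_right_mono_ennreal SUP_upper) simp
      ultimately show ?case using elim by simp
    qed
    then have "1 \<le> Liminf (at_right 0) (\<lambda>r. ?f (u - v) r / ?f u r)"
      by (rule Liminf_bounded)
    moreover have "Limsup (at_right 0) (\<lambda>r. ?f (u - v) r / ?f u r) \<le> 1"
      using weak v unfolding weak_mode_def by blast
    moreover have "Liminf (at_right 0) (\<lambda>r. ?f (u - v) r / ?f u r)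
        \<le> Limsup (at_right 0) (\<lambda>r. ?f (u - v) r / ?f u r)"
      by (rule Liminf_le_Limsup) simp
    ultimately have "((\<lambda>r. ?f (u - v) r / ?f u r) \<longlongrightarrow> 1) (at_right 0)"
      by (subst tendsto_iff_Liminf_eq_Limsup) auto
    then show "strong_mode smul \<mu> K u"
      unfolding strong_mode_def
      by (rule Lim_transform_eventually) (use attains_sup in eventually_elim, simp)
  next
    assume strong: "strong_mode smul \<mu> K u"
    then have lim: "((\<lambda>r. ?M r / ?f u r) \<longlongrightarrow> 1) (at_right 0)"
      unfolding strong_mode_def .
    have "Limsup (at_right 0) (\<lambda>r. ?f (u - w) r / ?f u r) \<le> 1" for w
    proof -
      have "Limsup (at_right 0) (\<lambda>r. ?f (u - w) r / ?f u r)
          \<le> Limsup (at_right 0) (\<lambda>r. ?M r / ?f u r)"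
        by (intro Limsup_mono always_eventually allI divide_right_mono_ennreal SUP_upper) simp
      also have "\<dots> = 1"
        using lim by (intro lim_imp_Limsup) auto
      finally show ?thesis .
    qed
    moreover have "u \<in> topological_support \<mu>"
      unfolding topological_support_def
    proof (intro CollectI allI impI)
      fix U assume U: "open U \<and> u \<in> U"
      \<comment> \<open>A quotient with denominator 0 is 0 or infinite; since the limit is 1, neither value
        occurs for small $r$, so $f(u,r) \<noteq> 0$.\<close>
      have "\<forall>\<^sub>F r in at_right 0. 0 < ?M r / ?f u r" "\<forall>\<^sub>F r in at_right 0. ?M r / ?f u r < top"
        by (rule order_tendstoD[OF lim], simp)+
      then have "\<forall>\<^sub>F r in at_right 0. 0 < ?f u r \<and> translate_dilate smul K u r \<subseteq> U"
        using eventually_translate_dilate_subset[OF assms(7) conjunct1[OF U] conjunct2[OF U]]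
      proof eventually_elim
        case (elim r)
        then show ?case
          by (cases "?f u r = 0") (auto simp: zero_less_iff_neq_zero split: if_splits)
      qed
      from eventually_happens'[OF trivial_limit_at_right_real this]
      obtain r where r: "0 < ?f u r" "translate_dilate smul K u r \<subseteq> U"
        by blast
      have "?f u r \<le> emeasure \<mu> U"
        unfolding small_ball_measure_def using r(2) U assms(2) by (intro emeasure_mono) auto
      with r(1) show "0 < emeasure \<mu> U"
        by (rule less_le_trans)
    qed
    ultimately show "weak_mode smul \<mu> K E u"
      unfolding weak_mode_def by blast
  qed
qed

end
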